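(* Let $M(x,y)=\sum_{n\ge1}\sum_{\sigma\in S_n(T_2)}x^ny^{asc(\sigma)}$, and let $N(x,y)=\sum_{P}x^{|P|/2}y^{peak(P)}$ be the Narayana generating function, the sum ranging over all Dyck paths $P$ (including the empty path). Then $$M(x,y)=\frac{x\,N(x,y)}{1-xN(x,y)^2}.$$
   Context: A permutation $\sigma$ avoids $\tau$ if no subsequence of $\sigma$ has the same relative order as $\tau$. $T_2=\{3124,3142,4123,4132\}$ and $S_n(T_2)$ is the set of permutations in $S_n$ avoiding all four patterns. $asc(\sigma)$ is the number of positions $i$ with $\sigma(i)<\sigma(i+1)$. A Dyck path is a lattice path from the origin with steps $U=(1,1)$, $D=(1,-1)$ never going below the $x$-axis and ending on it; $|P|$ is its length and $peak(P)$ the number of occurrences of the factor $UD$. *)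

theory Defs
  imports
    "HOL-Computational_Algebra.Formal_Power_Series"
    "HOL-Combinatorics.Multiset_Permutations"
    "HOL-Library.Sublist"
begin

text \<open>
  Permutations of \<open>{1..n}\<close> are given in one-line notation, i.e. as the lists in
  \<^term>\<open>permutations_of_set {1..n}\<close>. Note that \<^const>\<open>subseq\<close> is the relation
  "(not necessarily contiguous) subsequence".
\<close>

definition same_relative_order :: "nat list \<Rightarrow> nat list \<Rightarrow> bool" where
  "same_relative_order xs ys \<longleftrightarrow> length xs = length ys \<and>
     (\<forall>i < length xs. \<forall>j < length xs. xs ! i < xs ! j \<longleftrightarrow> ys ! i < ys ! j)"

definition avoids :: "nat list \<Rightarrow> nat list \<Rightarrow> bool" where
  "avoids \<sigma> \<tau> \<longleftrightarrow> \<not> (\<exists>\<rho>. subseq \<rho> \<sigma> \<and> same_relative_order \<rho> \<tau>)"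

definition avoiders :: "nat list set \<Rightarrow> nat \<Rightarrow> nat list set" where
  "avoiders T n = {\<sigma> \<in> permutations_of_set {1..n}. \<forall>\<tau>\<in>T. avoids \<sigma> \<tau>}"

definition T2 :: "nat list set" where
  "T2 = {[3,1,2,4], [3,1,4,2], [4,1,2,3], [4,1,3,2]}"

definition asc :: "nat list \<Rightarrow> nat" where
  "asc \<sigma> = card {i. Suc i < length \<sigma> \<and> \<sigma> ! i < \<sigma> ! Suc i}"

datatype step = U | D

fun rise :: "step \<Rightarrow> int" where
  "rise U = 1"
| "rise D = -1"

definition height :: "step list \<Rightarrow> int" where
  "height P = (\<Sum>s\<leftarrow>P. rise s)"

definition dyck_path :: "step list \<Rightarrow> bool" where
  "dyck_path P \<longleftrightarrow> (\<forall>k \<le> length P. 0 \<le> height (take k P)) \<and> height P = 0"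

definition peak :: "step list \<Rightarrow> nat" where
  "peak P = card {i. Suc i < length P \<and> P ! i = U \<and> P ! Suc i = D}"

text \<open>
  A power series in \<open>x, y\<close> is represented as a power series in \<open>x\<close> whose coefficients are power
  series in \<open>y\<close>: the outer \<^const>\<open>fps_X\<close> is \<open>x\<close>, the inner one is \<open>y\<close>. This type carries the
  library's division of power series, which is the true quotient whenever the constant
  coefficient of the denominator is invertible; here it is 1, see \<open>quotient_wellformed\<close> below.
\<close>

definition M :: "rat fps fps" where
  "M = Abs_fps (\<lambda>n. if n \<ge> 1 then \<Sum>\<sigma>\<in>avoiders T2 n. fps_X ^ asc \<sigma> else 0)"

text \<open>
  Every Dyck path has even length, so each one (including the empty one) is counted in exactly
  one coefficient.
\<close>

definition N :: "rat fps fps" where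
  "N = Abs_fps (\<lambda>n. \<Sum>P | dyck_path P \<and> length P = 2 * n. fps_X ^ peak P)"

lemma dyck_path_even_length: "dyck_path P \<Longrightarrow> even (length P)"
proof -
  have "even (height P) \<longleftrightarrow> even (length P)"
  proof (induction P)
    case (Cons s P)
    then show ?case by (cases s) (auto simp: height_def)
  qed (simp add: height_def)
  then show "dyck_path P \<Longrightarrow> even (length P)" by (simp add: dyck_path_def)
qed

lemma finite_dyck_paths: "finite {P. dyck_path P \<and> length P = 2 * n}"
proof -
  have "UNIV = {U, D}" using step.exhaust by blast
  then have "finite (UNIV :: step set)" by (metis finite.emptyI finite.insertI)
  then have "finite {P :: step list. set P \<subseteq> UNIV \<and> length P = 2 * n}"
    by (rule finite_lists_length_eq)
  then show ?thesis by (rule rev_finite_subset) auto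
qed

lemma finite_avoiders: "finite (avoiders T n)"
  by (simp add: avoiders_def)

lemma quotient_wellformed:
  "F / (1 - fps_X * N\<^sup>2) * (1 - fps_X * N\<^sup>2) = F"
proof -
  let ?d = "1 - fps_X * N\<^sup>2 :: rat fps fps"
  have d0: "fps_nth ?d 0 = 1" by simp
  have "?d * inverse ?d = 1"
    unfolding fps_inverse_def[of ?d] by (rule fps_right_inverse) (simp add: d0)
  then have inv: "inverse ?d * ?d = 1" by (simp add: mult.commute)
  have "F / ?d = F * inverse ?d"
    by (rule fps_divide_unit) (simp add: d0)
  then show ?thesis using inv by (simp add: mult.assoc)
qed

end

theory Submission
  imports Defs
begin

text \<open>
  A word avoids \<^const>\<open>T2\<close> iff, whenever a letter \<open>a\<close> is preceded by a larger letter \<open>p\<close> and followed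
  by two larger letters, both of the latter exceed \<open>p\<close>. Hence for a word \<open>L 1 R\<close> with minimum \<open>1\<close>
  the letter \<open>1\<close> imposes no condition if \<open>L\<close> is empty or \<open>R\<close> has at most one letter; otherwise all
  of \<open>L\<close> must lie below all of \<open>R\<close>, and then \<open>L R\<close> avoids \<^const>\<open>T2\<close> iff \<open>L\<close> avoids 312 and \<open>R\<close> avoids
  \<^const>\<open>T2\<close>. Let \<open>A\<close> count the nonempty 312-avoiders by ascents, and let \<open>Q\<close> count the
  \<^const>\<open>T2\<close>-avoiders of length at least 2 by the ascents before the last letter. Then
  \<open>M = x + xyM + xM + xyA(M - x) + xyQ\<close> and \<open>Q = x\<^sup>2 + xyQ + xM + xQ + xyAQ\<close>, where \<open>1 + yA = N\<close>
  because both sides satisfy \<open>F = 1 + x(F - 1 + y)F\<close>. Eliminating \<open>Q\<close> from this linear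
  system gives the formula.
\<close>

subsection \<open>Dyck paths\<close>

definition adjacent_count :: "('a \<Rightarrow> 'a \<Rightarrow> bool) \<Rightarrow> 'a list \<Rightarrow> nat" where
  "adjacent_count R xs = card {i. Suc i < length xs \<and> R (xs ! i) (xs ! Suc i)}"

lemma asc_eq_adjacent_count: "asc = adjacent_count (<)"
  by (auto simp: fun_eq_iff asc_def adjacent_count_def)

lemma peak_eq_adjacent_count: "peak = adjacent_count (\<lambda>s t. s = U \<and> t = D)"
  by (auto simp: fun_eq_iff peak_def adjacent_count_def)

lemma adjacent_count_Nil [simp]: "adjacent_count R [] = 0"
  by (simp add: adjacent_count_def)

lemma adjacent_count_Cons:
  "adjacent_count R (x # xs) = of_bool (xs \<noteq> [] \<and> R x (hd xs)) + adjacent_count R xs"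
proof -
  let ?I = "{i. Suc i < length xs \<and> R (xs ! i) (xs ! Suc i)}"
  let ?J = "{i. Suc i < length (x # xs) \<and> R ((x # xs) ! i) ((x # xs) ! Suc i)}"
  have "i \<in> ?J \<longleftrightarrow> i \<in> (if xs \<noteq> [] \<and> R x (hd xs) then {0} else {}) \<union> Suc ` ?I" for i
    by (cases i; cases xs) auto
  then have "?J = (if xs \<noteq> [] \<and> R x (hd xs) then {0} else {}) \<union> Suc ` ?I"
    by blast
  moreover have "finite ?I"
    by (rule finite_subset[of _ "{..<length xs}"]) auto
  moreover have "card (Suc ` ?I) = card ?I"
    by (rule card_image) simp
  moreover have "0 \<notin> Suc ` ?I" by simp
  ultimately show ?thesis
    by (simp add: adjacent_count_def card_insert_disjoint del: list.size nth_Cons_Suc)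
qed

lemma adjacent_count_append:
  "adjacent_count R (xs @ ys) = adjacent_count R xs + adjacent_count R ys
     + of_bool (xs \<noteq> [] \<and> ys \<noteq> [] \<and> R (last xs) (hd ys))"
  by (induction xs) (auto simp: adjacent_count_Cons hd_append)

lemma adjacent_count_map:
  "adjacent_count R (map f xs) = adjacent_count (\<lambda>x y. R (f x) (f y)) xs"
  by (induction xs) (auto simp: adjacent_count_Cons hd_map)

text \<open>The starting height is a parameter because a suffix of a Dyck path may start above the
  axis; this makes induction along the path possible.\<close>

fun dyck_from :: "nat \<Rightarrow> step list \<Rightarrow> bool" where
  "dyck_from h [] \<longleftrightarrow> h = 0"
| "dyck_from h (U # P) \<longleftrightarrow> dyck_from (Suc h) P"
| "dyck_from 0 (D # P) \<longleftrightarrow> False"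
| "dyck_from (Suc h) (D # P) \<longleftrightarrow> dyck_from h P"

lemma all_le_Suc: "(\<forall>k \<le> Suc n. Q k) \<longleftrightarrow> Q 0 \<and> (\<forall>k \<le> n. Q (Suc k))"
  using less_Suc_eq_0_disj[of _ "Suc n"] by (auto simp: less_Suc_eq_le)

lemma dyck_from_iff_height:
  "dyck_from h P \<longleftrightarrow>
     (\<forall>k \<le> length P. 0 \<le> int h + height (take k P)) \<and> int h + height P = 0"
proof (induction h P rule: dyck_from.induct)
  case (1 h)
  show ?case by (simp add: height_def)
next
  case (2 h P)
  have "(\<forall>k \<le> length (U # P). 0 \<le> int h + height (take k (U # P))) \<longleftrightarrow>
        (\<forall>k \<le> length P. 0 \<le> int (Suc h) + height (take k P))"
    by (simp add: all_le_Suc height_def algebra_simps)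
  with 2 show ?case by (simp add: height_def algebra_simps)
next
  case (3 P)
  have "\<not> 0 \<le> int 0 + height (take 1 (D # P))"
    by (simp add: height_def)
  then show ?case by (auto intro: exI[of _ 1])
next
  case (4 h P)
  have "(\<forall>k \<le> length (D # P). 0 \<le> int (Suc h) + height (take k (D # P))) \<longleftrightarrow>
        (\<forall>k \<le> length P. 0 \<le> int h + height (take k P))"
    by (simp add: all_le_Suc height_def algebra_simps)
  with 4 show ?case by (simp add: height_def algebra_simps)
qed

lemma dyck_path_iff_dyck_from: "dyck_path P \<longleftrightarrow> dyck_from 0 P"
  by (simp add: dyck_path_def dyck_from_iff_height)

text \<open>Lifted by \<open>h\<close>, the path \<open>P\<close> stays at height at least
  \<open>h\<close> and ends exactly there, so the whole word is judged by \<open>Q\<close>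
  alone.\<close>

lemma dyck_from_append: "dyck_from a P \<Longrightarrow> dyck_from (a + h) (P @ Q) \<longleftrightarrow> dyck_from h Q"
  by (induction a P rule: dyck_from.induct) auto

lemma last_dyck_from: "dyck_from h P \<Longrightarrow> P \<noteq> [] \<Longrightarrow> last P = D"
  by (induction h P rule: dyck_from.induct) auto

text \<open>The displayed \<open>D\<close> is the first step that leads from height
  \<open>Suc h\<close> down to \<open>h\<close>. The induction is on the length because the split is
  applied again to a remainder that is not the immediate tail.\<close>

lemma dyck_from_Suc_split:
  "dyck_from (Suc h) Q \<Longrightarrow> \<exists>P R. Q = P @ D # R \<and> dyck_from 0 P \<and> dyck_from h R"
proof (induction "length Q" arbitrary: h Q rule: less_induct)
  case less
  show ?case
  proof (cases Q)
    case Nil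
    with less.prems show ?thesis by simp
  next
    case (Cons s Q')
    show ?thesis
    proof (cases s)
      case D
      with Cons less.prems show ?thesis by (intro exI[of _ "[]"] exI[of _ Q']) auto
    next
      case U
      with Cons less.prems have "dyck_from (Suc (Suc h)) Q'" by simp
      \<comment> \<open>After an initial \<open>U\<close> two levels have to be descended. The two
        first descents yield \<open>P1\<close> and \<open>P2\<close>, and
        \<open>U # P1 @ D # P2\<close> is the excursion before the wanted \<open>D\<close>.\<close>
      with less.hyps[of Q' "Suc h"] Cons obtain P1 R1
        where 1: "Q' = P1 @ D # R1" "dyck_from 0 P1" "dyck_from (Suc h) R1" by auto
      with less.hyps[of R1 h] Cons obtain P2 R2
        where 2: "R1 = P2 @ D # R2" "dyck_from 0 P2" "dyck_from h R2" by auto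
      have "dyck_from 0 (U # P1 @ D # P2)"
        using dyck_from_append[OF 1(2), of 1 "D # P2"] 2(2) by simp
      then show ?thesis
        using Cons U 1(1) 2(1,3) by (intro exI[of _ "U # P1 @ D # P2"] exI[of _ R2]) simp
    qed
  qed
qed

text \<open>Started at height \<open>a\<close>, the \<open>D\<close> after \<open>P\<close> is the
  first step below the axis, so its position is determined by the word. Arbitrary \<open>a\<close>
  is needed for the induction.\<close>

lemma dyck_from_split_unique:
  "\<lbrakk>dyck_from a P; dyck_from a P'; P @ D # R = P' @ D # R'\<rbrakk> \<Longrightarrow> P = P'"
proof (induction a P arbitrary: P' rule: dyck_from.induct)
  case (1 h)
  then show ?case by (cases P') simp_all
next
  case (2 h P)
  from "2.prems"(2,3) obtain Q where Q: "P' = U # Q" by (cases P') simp_all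
  have "P = Q" by (rule "2.IH"[of Q]) (use "2.prems"[unfolded Q] in simp_all)
  with Q show ?case by simp
next
  case (3 P)
  then show ?case by simp
next
  case (4 h P)
  from "4.prems"(2,3) obtain Q where Q: "P' = D # Q" by (cases P') simp_all
  have "P = Q" by (rule "4.IH"[of Q]) (use "4.prems"[unfolded Q] in simp_all)
  with Q show ?case by simp
qed

section \<open>First-return decomposition and the Narayana equation\<close>

definition dyck_paths :: "nat \<Rightarrow> step list set" where
  "dyck_paths n = {P. dyck_path P \<and> length P = 2 * n}"

lemma finite_dyck_paths' [simp]: "finite (dyck_paths n)"
  unfolding dyck_paths_def by (rule finite_dyck_paths)

lemma dyck_paths_Suc:
  "bij_betw (\<lambda>(i, P, R). U # P @ D # R)
     (SIGMA i:{..n}. dyck_paths i \<times> dyck_paths (n - i)) (dyck_paths (Suc n))"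
  (is "bij_betw ?f ?S _")
proof (rule bij_betw_imageI)
  show "inj_on ?f ?S"
  proof (rule inj_onI)
    fix x y assume "x \<in> ?S" "y \<in> ?S" "?f x = ?f y"
    moreover obtain i P R where x: "x = (i, P, R)" by (cases x)
    moreover obtain j P' R' where y: "y = (j, P', R')" by (cases y)
    ultimately have P: "P \<in> dyck_paths i" "P' \<in> dyck_paths j"
      and eq: "P @ D # R = P' @ D # R'" by auto
    then have "P = P'"
      by (intro dyck_from_split_unique[of 0 P P' R R'])
        (simp_all add: dyck_paths_def dyck_path_iff_dyck_from)
    with P eq x y show "x = y"
      by (simp add: dyck_paths_def)
  qed
  show "?f ` ?S = dyck_paths (Suc n)"
  proof (intro equalityI subsetI)
    fix Q assume "Q \<in> ?f ` ?S"
    then obtain i P R where "i \<le> n" "P \<in> dyck_paths i" "R \<in> dyck_paths (n - i)"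
      "Q = U # P @ D # R" by auto
    then show "Q \<in> dyck_paths (Suc n)"
      using dyck_from_append[of 0 P 1 "D # R"]
      by (auto simp: dyck_paths_def dyck_path_iff_dyck_from)
  next
    fix Q assume Q: "Q \<in> dyck_paths (Suc n)"
    then obtain Q' where Q': "Q = U # Q'" "dyck_from 1 Q'"
      by (cases Q rule: list.exhaust; cases "hd Q")
        (auto simp: dyck_paths_def dyck_path_iff_dyck_from)
    with dyck_from_Suc_split[of 0 Q'] obtain P R
      where PR: "Q' = P @ D # R" "dyck_path P" "dyck_path R"
      by (auto simp: dyck_path_iff_dyck_from)
    have "even (length P)" using PR(2) by (rule dyck_path_even_length)
    then obtain i where i: "length P = 2 * i" by blast
    with Q Q' PR have "i \<le> n" "length R = 2 * (n - i)"
      by (auto simp: dyck_paths_def)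
    with i Q' PR show "Q \<in> ?f ` ?S"
      by (auto simp: dyck_paths_def intro!: image_eqI[of _ _ "(i, P, R)"])
  qed
qed

text \<open>A nonempty \<open>P\<close> starts with \<open>U\<close> and ends with \<open>D\<close>,
  so no junction creates a peak; for empty \<open>P\<close> the enclosing \<open>U\<close> and
  \<open>D\<close> form one themselves.\<close>

lemma peak_first_return:
  "peak (U # P @ D # R) = (if P = [] then 1 else peak P) + peak R" if "dyck_path P"
proof -
  have "P = [] \<or> (\<exists>P'. P = U # P') "
    using that by (cases P rule: list.exhaust; cases "hd P") (auto simp: dyck_path_iff_dyck_from)
  moreover have "P \<noteq> [] \<Longrightarrow> last P = D"
    using that last_dyck_from[of 0 P] by (auto simp: dyck_path_iff_dyck_from)
  ultimately show ?thesis
    by (auto simp: peak_eq_adjacent_count adjacent_count_Cons adjacent_count_append)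
qed

lemma N_nth: "fps_nth N n = (\<Sum>P\<in>dyck_paths n. fps_X ^ peak P)"
  by (simp add: N_def dyck_paths_def)

lemma N_equation: "N = 1 + fps_X * (N - 1 + fps_const fps_X) * N"
proof (rule fps_ext)
  fix n
  let ?F = "N - 1 + fps_const fps_X"
  have 0: "dyck_paths 0 = {[]}"
    by (auto simp: dyck_paths_def dyck_path_iff_dyck_from)
  \<comment> \<open>The series \<open>?F\<close> counts the blocks \<open>U P D\<close> by
    \<open>P\<close>: the empty \<open>P\<close> has weight \<open>y\<close> instead of 1, which is
    why \<open>N - 1 + y\<close> appears.\<close>
  have F_nth: "fps_nth ?F i = (\<Sum>P\<in>dyck_paths i. fps_X ^ (if P = [] then 1 else peak P))" for i
  proof (cases "i = 0")
    case True
    then show ?thesis by (simp add: N_nth 0 peak_eq_adjacent_count)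
  next
    case False
    then show ?thesis
      by (auto simp: N_nth dyck_paths_def intro!: sum.cong)
  qed
  show "fps_nth N n = fps_nth (1 + fps_X * ?F * N) n"
  proof (cases n)
    case 0
    then show ?thesis by (simp add: N_nth \<open>dyck_paths 0 = {[]}\<close> peak_eq_adjacent_count)
  next
    case (Suc m)
    have "fps_nth N (Suc m) = (\<Sum>(i, P, R)\<in>(SIGMA i:{..m}. dyck_paths i \<times> dyck_paths (m - i)).
        fps_X ^ peak (U # P @ D # R))"
      unfolding N_nth sum.reindex_bij_betw[OF dyck_paths_Suc, symmetric]
      by (simp add: case_prod_unfold)
    also have "\<dots> = (\<Sum>i\<le>m. \<Sum>(P, R)\<in>dyck_paths i \<times> dyck_paths (m - i).
        fps_X ^ (if P = [] then 1 else peak P) * fps_X ^ peak R)"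
      by (subst sum.Sigma[symmetric], simp, simp, intro sum.cong refl)
        (auto simp: peak_first_return dyck_paths_def power_add)
    also have "\<dots> = (\<Sum>i\<le>m. fps_nth ?F i * fps_nth N (m - i))"
      unfolding F_nth N_nth sum_product sum.cartesian_product ..
    also have "\<dots> = fps_nth (1 + fps_X * ?F * N) (Suc m)"
      by (simp only: mult.assoc fps_mult_nth[of ?F] atLeast0AtMost fps_add_nth fps_X_mult_nth) simp
    finally show ?thesis by (simp add: Suc)
  qed
qed

subsection \<open>Pattern avoidance and the minimal letter\<close>

definition avoids_312 :: "nat list \<Rightarrow> bool" where
  "avoids_312 xs \<longleftrightarrow> (\<forall>p a c. subseq [p, a, c] xs \<longrightarrow> a < p \<longrightarrow> a < c \<longrightarrow> p \<le> c)"

text \<open>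
  The four patterns of \<^const>\<open>T2\<close> are exactly the words \<open>p a c d\<close> in which \<open>a\<close> is the minimum and
  \<open>p\<close> is not the second smallest letter.
\<close>

definition avoids_T2 :: "nat list \<Rightarrow> bool" where
  "avoids_T2 xs \<longleftrightarrow>
     (\<forall>p a c d. subseq [p, a, c, d] xs \<longrightarrow> a < p \<longrightarrow> a < c \<longrightarrow> a < d \<longrightarrow> p \<le> c \<and> p \<le> d)"

lemma distinct_subseq: "subseq xs ys \<Longrightarrow> distinct ys \<Longrightarrow> distinct xs"
  by (auto simp: subseq_conv_nths distinct_nthsI)

lemma subseq_set_mem: "subseq xs ys \<Longrightarrow> x \<in> set xs \<Longrightarrow> x \<in> set ys"
  by (erule (1) list_emb_set) simp

lemma same_relative_order_4:
  "same_relative_order [p, a, c, d] [p', a', c', d'] \<longleftrightarrow>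
     (p < a \<longleftrightarrow> p' < a') \<and> (p < c \<longleftrightarrow> p' < c') \<and> (p < d \<longleftrightarrow> p' < d') \<and>
     (a < p \<longleftrightarrow> a' < p') \<and> (a < c \<longleftrightarrow> a' < c') \<and> (a < d \<longleftrightarrow> a' < d') \<and>
     (c < p \<longleftrightarrow> c' < p') \<and> (c < a \<longleftrightarrow> c' < a') \<and> (c < d \<longleftrightarrow> c' < d') \<and>
     (d < p \<longleftrightarrow> d' < p') \<and> (d < a \<longleftrightarrow> d' < a') \<and> (d < c \<longleftrightarrow> d' < c')"
  unfolding same_relative_order_def
  by (simp only: list.size All_less_Suc2 nth_Cons_0 nth_Cons_Suc not_less0 add_0_right add_Suc_right
      simp_thms less_irrefl conj_assoc)

lemma avoids_T2_iff:
  assumes "distinct xs"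
  shows "(\<forall>\<tau>\<in>T2. avoids xs \<tau>) \<longleftrightarrow> avoids_T2 xs"
proof
  assume *: "\<forall>\<tau>\<in>T2. avoids xs \<tau>"
  show "avoids_T2 xs"
    unfolding avoids_T2_def
  proof (intro allI impI, rule ccontr)
    fix p a c d
    assume sub: "subseq [p, a, c, d] xs" and less: "a < p" "a < c" "a < d" "\<not> (p \<le> c \<and> p \<le> d)"
    have "distinct [p, a, c, d]"
      using sub assms by (rule distinct_subseq)
    \<comment> \<open>As \<open>a\<close> is the minimum, only the order of \<open>p\<close>,
      \<open>c\<close>, \<open>d\<close> is open: \<open>p\<close> is the largest of them (first and
      third case) or the middle one (second and fourth).\<close>
    with less consider "c < d" "d < p" | "c < p" "p < d" | "d < c" "c < p" | "d < p" "p < c"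
      by fastforce
    then have "\<exists>\<tau>\<in>T2. same_relative_order [p, a, c, d] \<tau>"
    proof cases
      case 1
      with less show ?thesis
        by (intro bexI[of _ "[4, 1, 2, 3]"]) (simp_all add: same_relative_order_4 T2_def)
    next
      case 2
      with less show ?thesis
        by (intro bexI[of _ "[3, 1, 2, 4]"]) (simp_all add: same_relative_order_4 T2_def)
    next
      case 3
      with less show ?thesis
        by (intro bexI[of _ "[4, 1, 3, 2]"]) (simp_all add: same_relative_order_4 T2_def)
    next
      case 4
      with less show ?thesis
        by (intro bexI[of _ "[3, 1, 4, 2]"]) (simp_all add: same_relative_order_4 T2_def)
    qed
    with * sub show False by (auto simp: avoids_def)
  qed
next
  assume "avoids_T2 xs"
  show "\<forall>\<tau>\<in>T2. avoids xs \<tau>"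
    unfolding avoids_def
  proof safe
    fix \<tau> \<rho> assume \<tau>: "\<tau> \<in> T2" and \<rho>: "subseq \<rho> xs" "same_relative_order \<rho> \<tau>"
    have "length \<rho> = 4" using \<tau> \<rho>(2) by (auto simp: T2_def same_relative_order_def)
    then obtain p a c d where eq: "\<rho> = [p, a, c, d]"
      by (auto simp: numeral_eq_Suc length_Suc_conv)
    from \<tau> \<rho>(2) have "a < p \<and> a < c \<and> a < d \<and> \<not> (p \<le> c \<and> p \<le> d)"
      unfolding T2_def insert_iff empty_iff eq by (elim disjE) (simp_all add: same_relative_order_4)
    with \<open>avoids_T2 xs\<close> \<rho>(1) show False
      unfolding avoids_T2_def eq by blast
  qed
qed

text \<open>A 312 in \<open>xs\<close> is completed to a forbidden word by any letter of
  \<open>ys\<close>. Conversely, a forbidden word with \<open>p\<close> in \<open>xs\<close> has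
  \<open>a\<close> in \<open>xs\<close> too, and the one of \<open>c\<close>, \<open>d\<close> that
  is below \<open>p\<close> also lies in \<open>xs\<close>, giving a 312 there.\<close>

lemma avoids_T2_append:
  assumes "\<forall>x\<in>set xs. \<forall>y\<in>set ys. x < y" and "ys \<noteq> []"
  shows "avoids_T2 (xs @ ys) \<longleftrightarrow> avoids_312 xs \<and> avoids_T2 ys"
proof -
  note mem = subseq_set_mem
  have less: "x < y" if "subseq us xs" "subseq vs ys" "x \<in> set us" "y \<in> set vs" for us vs x y
    using assms(1) mem[OF that(1,3)] mem[OF that(2,4)] by blast
  show ?thesis
  proof
    assume *: "avoids_T2 (xs @ ys)"
    from assms(2) obtain y where y: "y \<in> set ys" by (cases ys) auto
    have "p \<le> c" if sub: "subseq [p, a, c] xs" and "a < p" "a < c" for p a c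
    proof -
      have "subseq ([p, a, c] @ [y]) (xs @ ys)"
        using sub y by (intro list_emb_append_mono) (simp_all add: subseq_singleton_left)
      moreover have "a < y" using less[OF sub, of "[y]" a y] y by (simp add: subseq_singleton_left)
      ultimately show ?thesis
        using * that unfolding avoids_T2_def by (metis append_Cons append_Nil)
    qed
    moreover have "avoids_T2 ys"
      using * unfolding avoids_T2_def by (meson subseq_drop_many)
    ultimately show "avoids_312 xs \<and> avoids_T2 ys"
      by (auto simp: avoids_312_def)
  next
    assume *: "avoids_312 xs \<and> avoids_T2 ys"
    show "avoids_T2 (xs @ ys)"
      unfolding avoids_T2_def
    proof (intro allI impI)
      fix p a c d
      assume sub: "subseq [p, a, c, d] (xs @ ys)" and "a < p" "a < c" "a < d"
      from sub obtain us vs where uv: "[p, a, c, d] = us @ vs" "subseq us xs" "subseq vs ys"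
        by (auto simp: subseq_append_iff)
      from uv(1) have "us = [] \<and> vs = [p, a, c, d] \<or> us = [p] \<and> vs = [a, c, d]
        \<or> us = [p, a] \<and> vs = [c, d] \<or> us = [p, a, c] \<and> vs = [d] \<or> us = [p, a, c, d]"
        by (auto simp: Cons_eq_append_conv)
      then consider "us = []" "vs = [p, a, c, d]" | "us = [p]" "vs = [a, c, d]"
        | "us = [p, a]" "vs = [c, d]" | "us = [p, a, c]" "vs = [d]" | "us = [p, a, c, d]"
        by blast
      then show "p \<le> c \<and> p \<le> d"
      proof cases
        case 1
        then show ?thesis using * uv \<open>a < p\<close> \<open>a < c\<close> \<open>a < d\<close> by (auto simp: avoids_T2_def)
      next
        case 2
        then show ?thesis using less[OF uv(2,3), of p a] \<open>a < p\<close> by simp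
      next
        case 3
        then show ?thesis using less[OF uv(2,3)] by (simp add: less_imp_le)
      next
        case 4
        then show ?thesis
          using less[OF uv(2,3)] * uv(2) \<open>a < p\<close> \<open>a < c\<close> by (simp add: avoids_312_def less_imp_le)
      next
        case 5
        have "subseq [p, a, c] [p, a, c, d]" "subseq [p, a, d] [p, a, c, d]" by auto
        with uv(2) 5 have "subseq [p, a, c] xs" "subseq [p, a, d] xs"
          by (metis subseq_order.order_trans)+
        with * show ?thesis using \<open>a < p\<close> \<open>a < c\<close> \<open>a < d\<close> by (auto simp: avoids_312_def)
      qed
    qed
  qed
qed

lemma subseq_insert_notin:
  "z \<notin> set us \<Longrightarrow> subseq us (xs @ z # ys) \<longleftrightarrow> subseq us (xs @ ys)"
proof (induction xs arbitrary: us)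
  case Nil
  then show ?case by (cases us) auto
next
  case (Cons x xs)
  then show ?case by (cases us) (auto simp: )
qed

text \<open>Being smaller than every other letter, \<open>z\<close> can only play the role of
  \<open>a\<close>; occurrences with another \<open>a\<close> do not involve
  \<open>z\<close>.\<close>

lemma avoids_T2_insert_min:
  assumes "\<forall>x\<in>set (xs @ ys). z < x"
  shows "avoids_T2 (xs @ z # ys) \<longleftrightarrow>
    avoids_T2 (xs @ ys) \<and> (\<forall>p\<in>set xs. \<forall>c d. subseq [c, d] ys \<longrightarrow> p \<le> c \<and> p \<le> d)"
proof -
  note mem = subseq_set_mem
  show ?thesis
  proof
    assume *: "avoids_T2 (xs @ z # ys)"
    have "avoids_T2 (xs @ ys)"
      unfolding avoids_T2_def
    proof (intro allI impI)
      fix p a c d assume "subseq [p, a, c, d] (xs @ ys)" "a < p" "a < c" "a < d"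
      moreover from this have "subseq [p, a, c, d] (xs @ z # ys)"
        by (meson list_emb_Cons list_emb_append_mono subseq_order.order_refl subseq_order.order_trans)
      ultimately show "p \<le> c \<and> p \<le> d" using * by (auto simp: avoids_T2_def)
    qed
    moreover have "p \<le> c \<and> p \<le> d" if "p \<in> set xs" "subseq [c, d] ys" for p c d
    proof -
      have "subseq ([p] @ [z, c, d]) (xs @ z # ys)"
        using that by (intro list_emb_append_mono) (simp_all add: subseq_singleton_left)
      moreover have "z < p" "z < c" "z < d"
        using assms that mem[of "[c, d]" ys] by auto
      ultimately show ?thesis using * unfolding avoids_T2_def by simp
    qed
    ultimately show "avoids_T2 (xs @ ys) \<and>
      (\<forall>p\<in>set xs. \<forall>c d. subseq [c, d] ys \<longrightarrow> p \<le> c \<and> p \<le> d)" by blast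
  next
    assume *: "avoids_T2 (xs @ ys) \<and> (\<forall>p\<in>set xs. \<forall>c d. subseq [c, d] ys \<longrightarrow> p \<le> c \<and> p \<le> d)"
    show "avoids_T2 (xs @ z # ys)"
      unfolding avoids_T2_def
    proof (intro allI impI)
      fix p a c d assume sub: "subseq [p, a, c, d] (xs @ z # ys)" and less: "a < p" "a < c" "a < d"
      show "p \<le> c \<and> p \<le> d"
      proof (cases "a = z")
        case False
        have "z \<le> a" using mem[OF sub, of a] assms by (auto simp: less_imp_le)
        with less False have "z \<notin> set [p, a, c, d]" by auto
        then have "subseq [p, a, c, d] (xs @ ys)" using sub by (rule subseq_insert_notin[THEN iffD1])
        with * less show ?thesis by (auto simp: avoids_T2_def)
      next
        case True
        have "z \<notin> set xs" "z \<notin> set ys" using assms by auto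
        then have "\<not> subseq us xs" "\<not> subseq us ys" if "z \<in> set us" for us
          using mem[OF _ that, of xs] mem[OF _ that, of ys] by auto
        with True sub less have "p \<in> set xs \<and> subseq [c, d] ys"
          by (auto simp: subseq_append_iff Cons_eq_append_conv subseq_singleton_left
              split: if_splits)
        with * show ?thesis by blast
      qed
    qed
  qed
qed

text \<open>With \<open>z\<close> as the middle letter, every \<open>x\<close> before and
  \<open>y\<close> after it must satisfy \<open>x < y\<close>. Once this holds, a 312 cannot have
  its first letter in \<open>xs\<close> and its last in \<open>ys\<close>, so it lies inside one of
  the two words.\<close>

lemma avoids_312_insert_min:
  assumes "\<forall>x\<in>set (xs @ ys). z < x" and "distinct (xs @ ys)"
  shows "avoids_312 (xs @ z # ys) \<longleftrightarrow>
    avoids_312 xs \<and> avoids_312 ys \<and> (\<forall>x\<in>set xs. \<forall>y\<in>set ys. x < y)"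
proof
  assume *: "avoids_312 (xs @ z # ys)"
  have "avoids_312 xs"
    using * unfolding avoids_312_def by (meson list_emb_prefix)
  moreover have "avoids_312 ys"
    using * unfolding avoids_312_def by (meson subseq_drop_many list_emb_Cons)
  moreover have "x < y" if "x \<in> set xs" "y \<in> set ys" for x y
  proof -
    have "subseq ([x] @ [z, y]) (xs @ z # ys)"
      using that by (intro list_emb_append_mono) (simp_all add: subseq_singleton_left)
    moreover have "z < x" "z < y" "x \<noteq> y" using assms that by auto
    ultimately show ?thesis
      using * unfolding avoids_312_def by (metis append_Cons append_Nil le_neq_implies_less)
  qed
  ultimately show "avoids_312 xs \<and> avoids_312 ys \<and> (\<forall>x\<in>set xs. \<forall>y\<in>set ys. x < y)" by blast
next
  assume *: "avoids_312 xs \<and> avoids_312 ys \<and> (\<forall>x\<in>set xs. \<forall>y\<in>set ys. x < y)"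
  show "avoids_312 (xs @ z # ys)"
    unfolding avoids_312_def
  proof (intro allI impI)
    fix p a c assume sub: "subseq [p, a, c] (xs @ z # ys)" and less: "a < p" "a < c"
    from sub obtain us vs where uv: "[p, a, c] = us @ vs" "subseq us xs" "subseq vs (z # ys)"
      by (auto simp: subseq_append_iff)
    have min: "z \<le> x" if "x \<in> set (z # ys)" for x
      using that assms(1) by (auto simp: less_imp_le)
    from uv(1) have "us = [] \<and> vs = [p, a, c] \<or> us = [p] \<and> vs = [a, c]
      \<or> us = [p, a] \<and> vs = [c] \<or> us = [p, a, c]"
      by (auto simp: Cons_eq_append_conv)
    then consider "us = []" "vs = [p, a, c]" | "us = [p]" "vs = [a, c]"
      | "us = [p, a]" "vs = [c]" | "us = [p, a, c]"
      by blast
    then show "p \<le> c"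
    proof cases
      case 1
      have "z \<le> a" using uv(3) subseq_set_mem[of vs "z # ys" a] 1 min by simp
      with less have "p \<noteq> z" by simp
      then have "subseq [p, a, c] ys" using uv(3) 1 by (simp add: subseq_Cons2_neq)
      with * less show ?thesis by (simp add: avoids_312_def)
    next
      case 2
      have "z \<le> a" using uv(3) subseq_set_mem[of vs "z # ys" a] 2 min by simp
      moreover have "c \<in> set (z # ys)" using uv(3) subseq_set_mem[of vs "z # ys" c] 2 by simp
      ultimately have "c \<in> set ys" using less by auto
      moreover have "p \<in> set xs" using uv(2) 2 by (simp add: subseq_singleton_left)
      ultimately show ?thesis using * by (simp add: less_imp_le)
    next
      case 3
      have "a \<in> set xs" "p \<in> set xs" using uv(2) 3 subseq_set_mem[of us xs] by auto
      then have "z < a" using assms(1) by simp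
      moreover have "c \<in> set (z # ys)" using uv(3) 3 subseq_set_mem[of vs "z # ys"] by simp
      ultimately have "c \<in> set ys" using less by auto
      with \<open>p \<in> set xs\<close> * show ?thesis by (simp add: less_imp_le)
    next
      case 4
      with uv * less show ?thesis by (simp add: avoids_312_def)
    qed
  qed
qed

subsection \<open>Sums over permutations of an interval\<close>

lemma permutations_of_set_insert_bij:
  assumes "finite A" "k \<notin> A"
  shows "bij_betw (\<lambda>(i, xs). take i xs @ k # drop i xs)
    ({..card A} \<times> permutations_of_set A) (permutations_of_set (insert k A))"
    (is "bij_betw ?f ?S _")
proof (rule bij_betw_imageI)
  have len: "length xs = card A" and k: "k \<notin> set xs" if "xs \<in> permutations_of_set A" for xs
    using that assms by (auto simp: length_finite_permutations_of_set permutations_of_setD)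
  show "inj_on ?f ?S"
  proof (rule inj_onI)
    fix u v assume "u \<in> ?S" "v \<in> ?S" "?f u = ?f v"
    moreover obtain i xs j ys where uv: "u = (i, xs)" "v = (j, ys)" by (cases u, cases v)
    ultimately have i: "i \<le> card A" "j \<le> card A"
      and xs: "xs \<in> permutations_of_set A" "ys \<in> permutations_of_set A"
      and eq: "take i xs @ k # drop i xs = take j ys @ k # drop j ys" by auto
    have "k \<notin> set (take i xs)" "k \<notin> set (drop i xs)"
      using k[OF xs(1)] by (auto dest: in_set_takeD in_set_dropD)
    with eq have "take i xs = take j ys" "drop i xs = drop j ys"
      by (simp_all add: append_Cons_eq_iff)
    then have "xs = ys" "length (take i xs) = length (take j ys)"
      by (metis append_take_drop_id, simp)
    then show "u = v" using uv i len[OF xs(1)] len[OF xs(2)] by simp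
  qed
  show "?f ` ?S = permutations_of_set (insert k A)"
  proof (intro equalityI subsetI)
    fix zs assume "zs \<in> ?f ` ?S"
    then obtain i xs where zs: "zs = take i xs @ k # drop i xs" and xs: "xs \<in> permutations_of_set A"
      by auto
    have insert: "set (us @ k # vs) = insert k (set (us @ vs))"
      "distinct (us @ k # vs) \<longleftrightarrow> k \<notin> set (us @ vs) \<and> distinct (us @ vs)" for us vs
      by auto
    have "set zs = insert k (set xs)" "distinct zs \<longleftrightarrow> k \<notin> set xs \<and> distinct xs"
      unfolding zs insert append_take_drop_id by (rule refl)+
    with xs k[OF xs] show "zs \<in> permutations_of_set (insert k A)"
      by (auto simp: permutations_of_setD intro!: permutations_of_setI)
  next
    fix zs assume zs: "zs \<in> permutations_of_set (insert k A)"
    then have "k \<in> set zs" by (simp add: permutations_of_setD)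
    then obtain xs ys where eq: "zs = xs @ k # ys" by (meson split_list)
    have "xs @ ys \<in> permutations_of_set A"
      using zs assms(2) unfolding eq by (auto simp: permutations_of_set_def)
    moreover from this len have "length xs \<le> card A" by fastforce
    ultimately show "zs \<in> ?f ` ?S"
      using eq by (auto intro!: image_eqI[of _ _ "(length xs, xs @ ys)"])
  qed
qed

text \<open>\<open>A\<close> is downward closed in the interval: anything below a member of
  \<open>A\<close> cannot lie in \<open>B\<close>. Hence \<open>x\<close> in \<open>A\<close> forces
  \<open>{a..x} \<subseteq> A\<close>, which bounds \<open>x\<close> by the size of
  \<open>A\<close>.\<close>

lemma lower_part_eq_interval:
  fixes a :: nat
  assumes "A \<union> B = {a..<a + n}" "\<forall>x\<in>A. \<forall>y\<in>B. x < y"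
  shows "A = {a..<a + card A}"
proof (rule card_subset_eq)
  have fin: "finite A" using assms(1) by (metis finite_Un finite_atLeastLessThan)
  show "A \<subseteq> {a..<a + card A}"
  proof
    fix x assume x: "x \<in> A"
    have "{a..x} \<subseteq> A"
    proof
      fix z assume z: "z \<in> {a..x}"
      moreover have "x < a + n" using x assms(1) by auto
      ultimately have "z \<in> A \<union> B" using assms(1) by auto
      moreover have "z \<notin> B" using z x assms(2) by fastforce
      ultimately show "z \<in> A" by blast
    qed
    with fin have "card {a..x} \<le> card A" by (rule card_mono)
    moreover have "a \<le> x" using x assms(1) by auto
    ultimately show "x \<in> {a..<a + card A}" by simp
  qed
qed simp_all

text \<open>If the first \<open>i\<close> letters lie below the rest, they are the \<open>i\<close>
  smallest. Both parts are then free permutations of intervals, which makes the sums factor.\<close>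

lemma permutations_of_interval_append_bij:
  fixes a i n :: nat
  assumes "i \<le> n"
  shows "bij_betw (\<lambda>(xs, ys). xs @ ys)
    (permutations_of_set {a..<a + i} \<times> permutations_of_set {a + i..<a + n})
    {zs \<in> permutations_of_set {a..<a + n}. \<forall>x\<in>set (take i zs). \<forall>y\<in>set (drop i zs). x < y}"
    (is "bij_betw ?f (?X \<times> ?Y) ?Z")
proof (rule bij_betw_imageI)
  have len: "length xs = i" if "xs \<in> ?X" for xs
    using that by (simp add: length_finite_permutations_of_set)
  show "inj_on ?f (?X \<times> ?Y)"
    using len by (auto intro!: inj_onI)
  show "?f ` (?X \<times> ?Y) = ?Z"
  proof (intro equalityI subsetI)
    fix zs assume "zs \<in> ?f ` (?X \<times> ?Y)"
    then obtain xs ys where "zs = xs @ ys" "xs \<in> ?X" "ys \<in> ?Y" by auto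
    with assms len[of xs] show "zs \<in> ?Z"
      by (auto simp: permutations_of_set_def ivl_disj_un)
  next
    fix zs assume zs: "zs \<in> ?Z"
    let ?xs = "take i zs" and ?ys = "drop i zs"
    have dist: "distinct zs" and set: "set zs = {a..<a + n}"
      using zs by (auto dest: permutations_of_setD)
    have "length zs = n"
      using zs length_finite_permutations_of_set[of zs "{a..<a + n}"] by simp
    then have "card (set ?xs) = i"
      using assms dist by (simp add: distinct_card)
    moreover have un: "set ?xs \<union> set ?ys = {a..<a + n}"
      using set by (metis append_take_drop_id set_append)
    ultimately have xs: "set ?xs = {a..<a + i}"
      using lower_part_eq_interval[OF un] zs by auto
    have "set ?xs \<inter> set ?ys = {}"
      using dist by (rule set_take_disj_set_drop_if_distinct) simp
    with un xs have "set ?ys = {a..<a + n} - {a..<a + i}" by blast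
    then have "set ?ys = {a + i..<a + n}" by auto
    with xs dist have "?xs \<in> ?X" "?ys \<in> ?Y"
      by (auto intro: permutations_of_setI)
    then show "zs \<in> ?f ` (?X \<times> ?Y)"
      by (intro image_eqI[of _ _ "(?xs, ?ys)"]) auto
  qed
qed

text \<open>This replaces invariance under standardization: all letter sets that occur are
  intervals, so translations suffice.\<close>

definition shift_invariant :: "(nat list \<Rightarrow> 'a) \<Rightarrow> bool" where
  "shift_invariant w \<longleftrightarrow> (\<forall>c xs. w (map ((+) c) xs) = w xs)"

text \<open>Letters start at 0, so that the minimum is the literal \<open>0\<close> and the other
  letters form the translated interval \<open>{1..<1 + n}\<close>.\<close>

definition word_sum :: "(nat list \<Rightarrow> 'a) \<Rightarrow> nat \<Rightarrow> 'a :: comm_semiring_1" where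
  "word_sum w n = (\<Sum>xs\<in>permutations_of_set {0..<n}. w xs)"

lemma word_sum_shift:
  assumes "shift_invariant w"
  shows "(\<Sum>xs\<in>permutations_of_set {a..<a + n}. w xs) = word_sum w n"
proof -
  have "permutations_of_set {a..<a + n} = map ((+) a) ` permutations_of_set {0..<n}"
    by (subst permutations_of_set_image_inj[symmetric]) (simp_all add: add.commute)
  moreover have "inj_on (map ((+) a)) (permutations_of_set {0..<n})"
    by (intro inj_on_mapI) simp
  ultimately show ?thesis
    using assms by (simp add: word_sum_def sum.reindex shift_invariant_def)
qed

lemma word_sum_0 [simp]: "word_sum w 0 = w []"
  by (simp add: word_sum_def)

lemma word_sum_cmult: "word_sum (\<lambda>xs. c * w xs) n = c * word_sum w n"
  by (simp add: word_sum_def sum_distrib_left)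

lemma word_sum_Suc:
  "word_sum w (Suc n) =
    (\<Sum>i\<le>n. \<Sum>xs\<in>permutations_of_set {1..<1 + n}. w (take i xs @ 0 # drop i xs))"
proof -
  have "{0..<Suc n} = insert 0 {1..<1 + n}" by auto
  then have "bij_betw (\<lambda>(i, xs). take i xs @ 0 # drop i xs)
    ({..n} \<times> permutations_of_set {1..<1 + n}) (permutations_of_set {0..<Suc n})"
    using permutations_of_set_insert_bij[of "{1..<1 + n}" 0] by simp
  from sum.reindex_bij_betw[OF this, of w] show ?thesis
    by (simp add: word_sum_def case_prod_unfold sum.cartesian_product)
qed

text \<open>For the positions \<open>i\<close> at which the minimum imposes no condition on the
  remaining word.\<close>

lemma insertion_sum_unsplit:
  assumes "shift_invariant g" "i \<le> n"
    and "\<And>xs ys. \<lbrakk>length xs = i; length ys = n - i; distinct (xs @ ys); 0 \<notin> set (xs @ ys)\<rbrakk>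
      \<Longrightarrow> w (xs @ 0 # ys) = g (xs @ ys)"
  shows "(\<Sum>xs\<in>permutations_of_set {1..<1 + n}. w (take i xs @ 0 # drop i xs)) = word_sum g n"
  unfolding word_sum_shift[OF assms(1), of 1 n, symmetric]
proof (rule sum.cong[OF refl])
  fix xs :: "nat list" assume "xs \<in> permutations_of_set {1..<1 + n}"
  then have "length xs = n" "distinct xs" "0 \<notin> set xs"
    by (auto simp: length_finite_permutations_of_set dest: permutations_of_setD)
  with assms(2) assms(3)[of "take i xs" "drop i xs"] show "w (take i xs @ 0 # drop i xs) = g xs"
    by (simp only: append_take_drop_id length_take length_drop) simp
qed

text \<open>For the positions at which the minimum forces everything on its left below everything on
  its right; the contribution is then a product.\<close>

lemma insertion_sum_split:
  assumes "shift_invariant g" "shift_invariant h" "i \<le> n"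
    and "\<And>xs ys. \<lbrakk>length xs = i; length ys = n - i; distinct (xs @ ys); 0 \<notin> set (xs @ ys)\<rbrakk>
      \<Longrightarrow> w (xs @ 0 # ys) = (if \<forall>x\<in>set xs. \<forall>y\<in>set ys. x < y then g xs * h ys else 0)"
  shows "(\<Sum>xs\<in>permutations_of_set {1..<1 + n}. w (take i xs @ 0 # drop i xs)) =
    word_sum g i * word_sum h (n - i)"
proof -
  let ?P = "\<lambda>i xs. \<forall>x\<in>set (take i xs). \<forall>y\<in>set (drop i xs). x < (y :: nat)"
  have "(\<Sum>xs\<in>permutations_of_set {1..<1 + n}. w (take i xs @ 0 # drop i xs)) =
    (\<Sum>xs\<in>permutations_of_set {1..<1 + n}. if ?P i xs then g (take i xs) * h (drop i xs) else 0)"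
  proof (rule sum.cong[OF refl])
    fix xs :: "nat list" assume "xs \<in> permutations_of_set {1..<1 + n}"
    then have "length xs = n" "distinct xs" "0 \<notin> set xs"
      by (auto simp: length_finite_permutations_of_set dest: permutations_of_setD)
    with assms(3) assms(4)[of "take i xs" "drop i xs"]
    show "w (take i xs @ 0 # drop i xs) = (if ?P i xs then g (take i xs) * h (drop i xs) else 0)"
      by (simp only: append_take_drop_id length_take length_drop) simp
  qed
  also have "\<dots> = (\<Sum>xs\<in>{xs \<in> permutations_of_set {1..<1 + n}. ?P i xs}. g (take i xs) * h (drop i xs))"
    by (rule sum.inter_filter[symmetric]) simp
  also have "\<dots> = (\<Sum>(xs, ys)\<in>permutations_of_set {1..<1 + i} \<times> permutations_of_set {1 + i..<1 + n}.
      g xs * h ys)"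
    unfolding sum.reindex_bij_betw[OF permutations_of_interval_append_bij[OF assms(3), of 1], symmetric]
    by (intro sum.cong) (auto simp: length_finite_permutations_of_set)
  also have "\<dots> = (\<Sum>xs\<in>permutations_of_set {1..<1 + i}. g xs) *
      (\<Sum>ys\<in>permutations_of_set {1 + i..<(1 + i) + (n - i)}. h ys)"
    using assms(3) by (simp add: sum_product sum.cartesian_product)
  also have "\<dots> = word_sum g i * word_sum h (n - i)"
    by (simp only: word_sum_shift[OF assms(1)] word_sum_shift[OF assms(2)])
  finally show ?thesis .
qed

subsection \<open>Ascent weights of avoiders\<close>

lemma subseq_map_iff:
  "subseq xs (map f ys) \<longleftrightarrow> (\<exists>us. xs = map f us \<and> subseq us ys)"
  by (auto simp: subseq_conv_nths nths_map)

lemma avoids_312_shift: "avoids_312 (map ((+) k) xs) \<longleftrightarrow> avoids_312 xs"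
  by (fastforce simp: avoids_312_def subseq_map_iff Cons_eq_map_conv)

lemma avoids_T2_shift: "avoids_T2 (map ((+) k) xs) \<longleftrightarrow> avoids_T2 xs"
  by (fastforce simp: avoids_T2_def subseq_map_iff Cons_eq_map_conv)

lemma asc_shift: "asc (map ((+) k) xs) = asc xs"
  by (simp add: asc_eq_adjacent_count adjacent_count_map)

text \<open>The step into \<open>0\<close> is never an ascent and the step out of it always is. The
  step that \<open>0\<close> interrupts is counted in neither part.\<close>

lemma asc_insert_zero:
  "0 \<notin> set ys \<Longrightarrow> asc (xs @ 0 # ys) = asc xs + asc ys + of_bool (ys \<noteq> [])"
  by (cases ys) (auto simp: asc_eq_adjacent_count adjacent_count_append adjacent_count_Cons)

definition weight_312 :: "nat list \<Rightarrow> rat fps" where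
  "weight_312 xs = of_bool (avoids_312 xs) * fps_X ^ asc xs"

definition weight_T2 :: "nat list \<Rightarrow> rat fps" where
  "weight_T2 xs = of_bool (avoids_T2 xs) * fps_X ^ asc xs"

text \<open>
  Inserting a new minimum just before the last letter always produces an ascent at the end, whether
  or not the last step was one. The statistic \<^term>\<open>asc (butlast xs)\<close> controls this case.
\<close>

definition weight_T2_butlast :: "nat list \<Rightarrow> rat fps" where
  "weight_T2_butlast xs = of_bool (avoids_T2 xs) * fps_X ^ asc (butlast xs)"

lemma shift_invariant_weight_312: "shift_invariant weight_312"
  by (simp add: shift_invariant_def weight_312_def avoids_312_shift asc_shift)

lemma shift_invariant_weight_T2: "shift_invariant weight_T2"
  by (simp add: shift_invariant_def weight_T2_def avoids_T2_shift asc_shift)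

lemma shift_invariant_weight_T2_butlast: "shift_invariant weight_T2_butlast"
  by (simp add: shift_invariant_def weight_T2_butlast_def avoids_T2_shift map_butlast[symmetric] asc_shift)

lemma shift_invariant_cmult: "shift_invariant w \<Longrightarrow> shift_invariant (\<lambda>xs. c * w xs)"
  by (simp add: shift_invariant_def)

lemma avoids_T2_short: "length xs < 4 \<Longrightarrow> avoids_T2 xs"
  by (simp add: avoids_T2_def)

lemma avoids_312_Nil [simp]: "avoids_312 []"
  by (simp add: avoids_312_def)

lemma avoids_T2_zero_Cons: "0 \<notin> set ys \<Longrightarrow> avoids_T2 (0 # ys) \<longleftrightarrow> avoids_T2 ys"
  using avoids_T2_insert_min[of "[]" ys 0] by (auto simp: Suc_le_eq intro: gr0I)

lemma avoids_T2_zero_near_end: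
  assumes "0 \<notin> set (xs @ ys)" "length ys \<le> 1"
  shows "avoids_T2 (xs @ 0 # ys) \<longleftrightarrow> avoids_T2 (xs @ ys)"
proof -
  have "\<forall>x\<in>set (xs @ ys). 0 < x" using assms(1) by (metis gr0I)
  then show ?thesis
    using assms(2) by (subst avoids_T2_insert_min) auto
qed

text \<open>With at least two letters in \<open>ys\<close>, each of them belongs to some two-letter
  subsequence, so the condition on pairs from \<open>avoids_T2_insert_min\<close> becomes a
  condition on all letters. Then \<open>avoids_T2_append\<close> applies.\<close>

lemma avoids_T2_zero_inside:
  assumes "0 \<notin> set (xs @ ys)" "distinct (xs @ ys)" "length ys \<ge> 2"
  shows "avoids_T2 (xs @ 0 # ys) \<longleftrightarrow>
    avoids_312 xs \<and> avoids_T2 ys \<and> (\<forall>x\<in>set xs. \<forall>y\<in>set ys. x < y)"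
proof -
  have pos: "\<forall>x\<in>set (xs @ ys). 0 < x" using assms(1) by (metis gr0I)
  have "(\<forall>c d. subseq [c, d] ys \<longrightarrow> p \<le> c \<and> p \<le> d) \<longleftrightarrow> (\<forall>y\<in>set ys. p < y)"
    if p: "p \<in> set xs" for p
  proof
    assume *: "\<forall>c d. subseq [c, d] ys \<longrightarrow> p \<le> c \<and> p \<le> d"
    show "\<forall>y\<in>set ys. p < y"
    proof
      fix y assume y: "y \<in> set ys"
      then obtain us vs where eq: "ys = us @ y # vs" by (meson split_list)
      have "us \<noteq> [] \<or> vs \<noteq> []" using assms(3) eq by auto
      then have "\<exists>z. subseq [z, y] ys \<or> subseq [y, z] ys"
      proof
        assume "us \<noteq> []"
        then have "subseq ([hd us] @ [y]) (us @ y # vs)"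
          by (intro list_emb_append_mono) (simp_all add: subseq_singleton_left)
        then show ?thesis unfolding eq by auto
      next
        assume "vs \<noteq> []"
        then have "subseq ([] @ [y, hd vs]) (us @ y # vs)"
          by (intro list_emb_append_mono) (simp_all add: subseq_singleton_left)
        then show ?thesis unfolding eq by auto
      qed
      with * have "p \<le> y" by blast
      moreover have "p \<noteq> y" using assms(2) p y by auto
      ultimately show "p < y" by simp
    qed
  next
    assume *: "\<forall>y\<in>set ys. p < y"
    show "\<forall>c d. subseq [c, d] ys \<longrightarrow> p \<le> c \<and> p \<le> d"
    proof (intro allI impI)
      fix c d assume "subseq [c, d] ys"
      then have "c \<in> set ys" "d \<in> set ys" using subseq_set_mem[of "[c, d]" ys] by auto
      with * show "p \<le> c \<and> p \<le> d" by (simp add: less_imp_le)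
    qed
  qed
  then have "avoids_T2 (xs @ 0 # ys) \<longleftrightarrow>
      avoids_T2 (xs @ ys) \<and> (\<forall>x\<in>set xs. \<forall>y\<in>set ys. x < y)"
    using avoids_T2_insert_min[OF pos] by blast
  moreover have "ys \<noteq> []" using assms(3) by auto
  ultimately show ?thesis using avoids_T2_append[of xs ys] by blast
qed

lemma avoids_312_insert_zero:
  assumes "0 \<notin> set (xs @ ys)" "distinct (xs @ ys)"
  shows "avoids_312 (xs @ 0 # ys) \<longleftrightarrow>
    avoids_312 xs \<and> avoids_312 ys \<and> (\<forall>x\<in>set xs. \<forall>y\<in>set ys. x < y)"
  using assms by (intro avoids_312_insert_min) (auto intro: gr0I)

lemma weight_312_Nil: "weight_312 [] = 1"
  by (simp add: weight_312_def asc_eq_adjacent_count)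

subsection \<open>Recurrences\<close>

lemma word_sum_weight_312_Suc:
  "word_sum weight_312 (Suc n) = (\<Sum>i\<le>n. word_sum weight_312 i *
    (if i = n then 1 else fps_X * word_sum weight_312 (n - i)))"
  unfolding word_sum_Suc
proof (rule sum.cong[OF refl])
  fix i assume "i \<in> {..n}"
  then have i: "i \<le> n" by simp
  \<comment> \<open>A minimum in last position is followed by no ascent, hence the factor 1 for
    \<open>i = n\<close>.\<close>
  let ?c = "if i = n then 1 else fps_X :: rat fps"
  have "(\<Sum>xs\<in>permutations_of_set {1..<1 + n}. weight_312 (take i xs @ 0 # drop i xs)) =
    word_sum weight_312 i * word_sum (\<lambda>ys. ?c * weight_312 ys) (n - i)"
  proof (rule insertion_sum_split[OF shift_invariant_weight_312
      shift_invariant_cmult[OF shift_invariant_weight_312] i])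
    fix xs ys :: "nat list"
    assume "length xs = i" "length ys = n - i" "distinct (xs @ ys)" "0 \<notin> set (xs @ ys)"
    moreover from this i have "ys = [] \<longleftrightarrow> i = n" by auto
    ultimately show "weight_312 (xs @ 0 # ys) =
      (if \<forall>x\<in>set xs. \<forall>y\<in>set ys. x < y then weight_312 xs * (?c * weight_312 ys) else 0)"
      unfolding weight_312_def
      by (auto simp: avoids_312_insert_zero asc_insert_zero power_add mult_ac)
  qed
  then show "(\<Sum>xs\<in>permutations_of_set {1..<1 + n}. weight_312 (take i xs @ 0 # drop i xs)) =
    word_sum weight_312 i * (if i = n then 1 else fps_X * word_sum weight_312 (n - i))"
    unfolding word_sum_cmult by (simp add: weight_312_Nil)
qed

lemma sum_atMost_split:
  fixes f :: "nat \<Rightarrow> 'a :: comm_monoid_add"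
  assumes "n \<ge> 2"
  shows "(\<Sum>i\<le>n. f i) = f 0 + (\<Sum>i\<in>{1..<n - 1}. f i) + f (n - 1) + f n"
proof -
  have "{..n} = insert 0 {1..<n - 1} \<union> {n - 1, n}" using assms by auto
  also have "sum f \<dots> = sum f (insert 0 {1..<n - 1}) + sum f {n - 1, n}"
    using assms by (intro sum.union_disjoint) auto
  finally show ?thesis using assms by (simp add: add.assoc)
qed

text \<open>The four terms belong to the minimum in first, inner, second to last and last position.
  In the second to last position the final step is always an ascent and the former final step is
  lost, hence \<open>weight_T2_butlast\<close>.\<close>

lemma word_sum_weight_T2_Suc:
  assumes "n \<ge> 2"
  shows "word_sum weight_T2 (Suc n) = fps_X * word_sum weight_T2 n +
    fps_X * (\<Sum>i\<in>{1..<n - 1}. word_sum weight_312 i * word_sum weight_T2 (n - i)) +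
    fps_X * word_sum weight_T2_butlast n + word_sum weight_T2 n"
proof -
  let ?f = "\<lambda>i. \<Sum>xs\<in>permutations_of_set {1..<1 + n}. weight_T2 (take i xs @ 0 # drop i xs)"
  have "?f 0 = word_sum (\<lambda>xs. fps_X * weight_T2 xs) n"
  proof (rule insertion_sum_unsplit[OF shift_invariant_cmult[OF shift_invariant_weight_T2]])
    fix xs ys :: "nat list" assume "length xs = 0" "length ys = n - 0" "0 \<notin> set (xs @ ys)"
    with assms show "weight_T2 (xs @ 0 # ys) = fps_X * weight_T2 (xs @ ys)"
      using asc_insert_zero[of ys "[]"]
      by (auto simp: weight_T2_def avoids_T2_zero_Cons asc_eq_adjacent_count)
  qed simp
  moreover have "?f n = word_sum weight_T2 n"
  proof (rule insertion_sum_unsplit[OF shift_invariant_weight_T2])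
    fix xs ys :: "nat list" assume "length ys = n - n" "0 \<notin> set (xs @ ys)"
    then show "weight_T2 (xs @ 0 # ys) = weight_T2 (xs @ ys)"
      using asc_insert_zero[of "[]" xs] avoids_T2_zero_near_end[of xs ys]
      by (simp add: weight_T2_def asc_eq_adjacent_count)
  qed simp
  moreover have "?f (n - 1) = word_sum (\<lambda>xs. fps_X * weight_T2_butlast xs) n"
  proof (rule insertion_sum_unsplit[OF shift_invariant_cmult[OF shift_invariant_weight_T2_butlast]])
    fix xs ys :: "nat list" assume "length ys = n - (n - 1)" "0 \<notin> set (xs @ ys)"
    moreover from this assms obtain y where "ys = [y]" by (auto simp: length_Suc_conv)
    ultimately show "weight_T2 (xs @ 0 # ys) = fps_X * weight_T2_butlast (xs @ ys)"
      using asc_insert_zero[of "[y]" xs] avoids_T2_zero_near_end[of xs ys]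
      by (simp add: weight_T2_def weight_T2_butlast_def asc_eq_adjacent_count adjacent_count_Cons)
  qed simp
  moreover have "?f i = word_sum weight_312 i * word_sum (\<lambda>xs. fps_X * weight_T2 xs) (n - i)"
    if i: "i \<in> {1..<n - 1}" for i
  proof (rule insertion_sum_split[OF shift_invariant_weight_312
      shift_invariant_cmult[OF shift_invariant_weight_T2]])
    fix xs ys :: "nat list"
    assume "length xs = i" "length ys = n - i" "distinct (xs @ ys)" "0 \<notin> set (xs @ ys)"
    moreover from this i have "2 \<le> length ys" by auto
    moreover from this have "ys \<noteq> []" by auto
    ultimately show "weight_T2 (xs @ 0 # ys) =
      (if \<forall>x\<in>set xs. \<forall>y\<in>set ys. x < y then weight_312 xs * (fps_X * weight_T2 ys) else 0)"
      unfolding weight_312_def weight_T2_def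
      by (auto simp: avoids_T2_zero_inside asc_insert_zero power_add mult_ac)
  qed (use i in auto)
  ultimately show ?thesis
    unfolding word_sum_Suc sum_atMost_split[OF assms]
    by (simp add: word_sum_cmult sum_distrib_left mult.left_commute)
qed

text \<open>The positions are the same as for \<open>weight_T2\<close>. Dropping the last letter
  leaves a second to last minimum at the end, so no factor \<open>y\<close> arises; a minimum in
  last position is itself dropped, so the full ascent weight of the remaining word
  reappears.\<close>

lemma word_sum_weight_T2_butlast_Suc:
  assumes "n \<ge> 2"
  shows "word_sum weight_T2_butlast (Suc n) = fps_X * word_sum weight_T2_butlast n +
    fps_X * (\<Sum>i\<in>{1..<n - 1}. word_sum weight_312 i * word_sum weight_T2_butlast (n - i)) +
    word_sum weight_T2_butlast n + word_sum weight_T2 n"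
proof -
  let ?f = "\<lambda>i. \<Sum>xs\<in>permutations_of_set {1..<1 + n}. weight_T2_butlast (take i xs @ 0 # drop i xs)"
  have asc_butlast: "asc (butlast (xs @ 0 # ys)) = asc xs + asc (butlast ys) + 1"
    if "0 \<notin> set ys" "length ys \<ge> 2" for xs ys
  proof -
    have "butlast ys \<noteq> []" "ys \<noteq> []" using that(2) by (auto simp: butlast_conv_take)
    moreover have "0 \<notin> set (butlast ys)" using that(1) by (auto dest: in_set_butlastD)
    ultimately show ?thesis
      using asc_insert_zero[of "butlast ys" xs] by (simp add: butlast_append)
  qed
  have "?f 0 = word_sum (\<lambda>xs. fps_X * weight_T2_butlast xs) n"
  proof (rule insertion_sum_unsplit[OF shift_invariant_cmult[OF shift_invariant_weight_T2_butlast]])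
    fix xs ys :: "nat list" assume "length xs = 0" "length ys = n - 0" "0 \<notin> set (xs @ ys)"
    with assms show "weight_T2_butlast (xs @ 0 # ys) = fps_X * weight_T2_butlast (xs @ ys)"
      using asc_butlast[of ys "[]"]
      by (simp add: weight_T2_butlast_def avoids_T2_zero_Cons asc_eq_adjacent_count)
  qed simp
  moreover have "?f n = word_sum weight_T2 n"
  proof (rule insertion_sum_unsplit[OF shift_invariant_weight_T2])
    fix xs ys :: "nat list" assume "length ys = n - n" "0 \<notin> set (xs @ ys)"
    then show "weight_T2_butlast (xs @ 0 # ys) = weight_T2 (xs @ ys)"
      using avoids_T2_zero_near_end[of xs ys]
      by (simp add: weight_T2_def weight_T2_butlast_def)
  qed simp
  moreover have "?f (n - 1) = word_sum weight_T2_butlast n"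
  proof (rule insertion_sum_unsplit[OF shift_invariant_weight_T2_butlast])
    fix xs ys :: "nat list" assume "length ys = n - (n - 1)" "0 \<notin> set (xs @ ys)"
    moreover from this assms obtain y where "ys = [y]" by (auto simp: length_Suc_conv)
    ultimately show "weight_T2_butlast (xs @ 0 # ys) = weight_T2_butlast (xs @ ys)"
      using asc_insert_zero[of "[]" xs] avoids_T2_zero_near_end[of xs ys]
      by (simp add: weight_T2_butlast_def asc_eq_adjacent_count butlast_append)
  qed simp
  moreover have "?f i = word_sum weight_312 i * word_sum (\<lambda>xs. fps_X * weight_T2_butlast xs) (n - i)"
    if i: "i \<in> {1..<n - 1}" for i
  proof (rule insertion_sum_split[OF shift_invariant_weight_312
      shift_invariant_cmult[OF shift_invariant_weight_T2_butlast]])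
    fix xs ys :: "nat list"
    assume "length xs = i" "length ys = n - i" "distinct (xs @ ys)" "0 \<notin> set (xs @ ys)"
    moreover from this i have "2 \<le> length ys" by auto
    ultimately show "weight_T2_butlast (xs @ 0 # ys) =
      (if \<forall>x\<in>set xs. \<forall>y\<in>set ys. x < y then weight_312 xs * (fps_X * weight_T2_butlast ys) else 0)"
      unfolding weight_312_def weight_T2_butlast_def
      by (auto simp: avoids_T2_zero_inside asc_butlast power_add mult_ac)
  qed (use i in auto)
  ultimately show ?thesis
    unfolding word_sum_Suc sum_atMost_split[OF assms]
    by (simp add: word_sum_cmult sum_distrib_left mult.left_commute)
qed

subsection \<open>Generating functions\<close>

text \<open>Subtracting the equations, \<open>F - G\<close> times a series with constant coefficient
  1 vanishes.\<close>

lemma narayana_equation_unique: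
  fixes F G y :: "rat fps fps"
  assumes "F = 1 + fps_X * (F - 1 + y) * F" "G = 1 + fps_X * (G - 1 + y) * G"
  shows "F = G"
proof -
  have "(F - G) * (1 - fps_X * (F + G - 1 + y)) = 0"
    using assms by algebra
  moreover have "fps_nth (1 - fps_X * (F + G - 1 + y)) 0 \<noteq> 0" by simp
  then have "1 - fps_X * (F + G - 1 + y) \<noteq> 0" by (metis fps_zero_nth)
  ultimately show ?thesis by simp
qed

text \<open>The empty word is included, so the series \<open>A\<close> of the overview is
  \<open>series_312 - 1\<close>.\<close>

definition series_312 :: "rat fps fps" where
  "series_312 = Abs_fps (\<lambda>n. word_sum weight_312 n)"

text \<open>This is \<open>Q\<close> of the overview. Length 1 is left out because, before a single
  letter, the first and the second to last position coincide and must not be counted twice.\<close>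

definition series_T2_butlast :: "rat fps fps" where
  "series_T2_butlast = Abs_fps (\<lambda>n. if n \<ge> 2 then word_sum weight_T2_butlast n else 0)"

lemma M_nth: "fps_nth M n = (if n \<ge> 1 then word_sum weight_T2 n else 0)"
proof -
  have "avoiders T2 n = {\<sigma> \<in> permutations_of_set {1..n}. avoids_T2 \<sigma>}"
    unfolding avoiders_def using avoids_T2_iff permutations_of_setD(2) by blast
  then have "(\<Sum>\<sigma>\<in>avoiders T2 n. fps_X ^ asc \<sigma>) = (\<Sum>\<sigma>\<in>permutations_of_set {1..n}. weight_T2 \<sigma>)"
    by (intro sum.mono_neutral_cong_left) (auto simp: weight_T2_def)
  also have "{1..n} = {1..<1 + n}" by auto
  finally show ?thesis
    using word_sum_shift[OF shift_invariant_weight_T2, of 1 n] by (simp add: M_def)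
qed

lemma N_eq_series_312: "N = 1 + fps_const fps_X * (series_312 - 1)"
proof (rule narayana_equation_unique[OF N_equation])
  let ?y = "fps_const fps_X :: rat fps fps" and ?A = series_312
  have "?A = 1 + fps_X * (?A * (1 + ?y * (?A - 1)))"
  proof (rule fps_ext)
    fix n
    show "fps_nth ?A n = fps_nth (1 + fps_X * (?A * (1 + ?y * (?A - 1)))) n"
    proof (cases n)
      case 0
      then show ?thesis by (simp add: series_312_def weight_312_Nil)
    next
      case (Suc m)
      have "fps_nth (1 + ?y * (?A - 1)) (m - i) =
          (if i = m then 1 else fps_X * word_sum weight_312 (m - i))" if "i \<le> m" for i
        using that by (simp add: series_312_def weight_312_Nil)
      then have "fps_nth (?A * (1 + ?y * (?A - 1))) m = word_sum weight_312 (Suc m)"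
        unfolding word_sum_weight_312_Suc fps_mult_nth atLeast0AtMost
        by (intro sum.cong) (auto simp: series_312_def)
      then show ?thesis by (simp add: Suc series_312_def)
    qed
  qed
  \<comment> \<open>For \<open>F = 1 + y(A' - 1)\<close> with \<open>A' = series_312\<close> one has
    \<open>F - 1 + y = yA'\<close>, so multiplying the equation of \<open>A'\<close> by
    \<open>y\<close> gives the Narayana equation for \<open>F\<close>.\<close>
  then show "1 + ?y * (?A - 1) =
      1 + fps_X * (1 + ?y * (?A - 1) - 1 + ?y) * (1 + ?y * (?A - 1))"
    by algebra
qed

text \<open>The vanishing low coefficients of both factors remove the indices \<open>0\<close>,
  \<open>n - 1\<close> and \<open>n\<close> from the convolution, leaving the inner positions of the
  recurrences.\<close>

lemma fps_nth_series_312_mult: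
  assumes "n \<ge> 2" "fps_nth F 0 = 0" "fps_nth F 1 = 0" "\<And>j. j \<ge> 2 \<Longrightarrow> fps_nth F j = f j"
  shows "fps_nth ((series_312 - 1) * F) n = (\<Sum>i\<in>{1..<n - 1}. word_sum weight_312 i * f (n - i))"
proof -
  have "(\<Sum>i\<in>{1..<n - 1}. fps_nth (series_312 - 1) i * fps_nth F (n - i)) =
    (\<Sum>i\<in>{1..<n - 1}. word_sum weight_312 i * f (n - i))"
    by (intro sum.cong) (auto simp: series_312_def assms(4))
  then show ?thesis
    unfolding fps_mult_nth atLeast0AtMost sum_atMost_split[OF assms(1)]
    using assms(1-3) by (simp add: series_312_def weight_312_Nil)
qed

lemma words_of_length_2: "permutations_of_set {0..<2::nat} = {[0, 1], [1, 0]}"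
proof -
  have "{0..<2::nat} = {0, 1}" by auto
  then show ?thesis by (simp add: permutations_of_set_doubleton)
qed

lemma M_equation:
  "M = fps_X * (1 + fps_const fps_X * M + M
     + fps_const fps_X * ((series_312 - 1) * (M - fps_X)) + fps_const fps_X * series_T2_butlast)"
  (is "_ = fps_X * ?R")
proof (rule fps_ext)
  fix n
  have 1: "word_sum weight_T2 1 = 1"
    by (simp add: word_sum_def weight_T2_def avoids_T2_short asc_eq_adjacent_count adjacent_count_Cons)
  have 2: "word_sum weight_T2 2 = 1 + fps_X"
    by (simp add: word_sum_def words_of_length_2 weight_T2_def avoids_T2_short
        asc_eq_adjacent_count adjacent_count_Cons)
  \<comment> \<open>The recurrence starts at length 3, so lengths up to 2 are computed directly.
    Subtracting \<open>fps_X\<close> from \<open>M\<close> reflects that the right part has at least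
    two letters at inner positions.\<close>
  consider "n = 0" | "n = 1" | "n = 2" | m where "n = Suc m" "m \<ge> 2"
    by (metis One_nat_def Suc_1 Suc_leI less_2_cases_iff not_less not0_implies_Suc)
  then show "fps_nth M n = fps_nth (fps_X * ?R) n"
  proof cases
    case 3
    then show ?thesis
      by (simp add: M_nth 1[simplified] 2 fps_mult_nth[of "_ - _"] series_T2_butlast_def
          series_312_def weight_312_Nil)
  next
    case 4
    have "fps_nth ((series_312 - 1) * (M - fps_X)) m =
        (\<Sum>i\<in>{1..<m - 1}. word_sum weight_312 i * word_sum weight_T2 (m - i))"
      using 4(2) by (intro fps_nth_series_312_mult) (simp_all add: M_nth 1[simplified])
    then have "fps_nth ?R m = word_sum weight_T2 (Suc m)"
      using 4(2) unfolding word_sum_weight_T2_Suc[OF 4(2)]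
      by (simp add: M_nth series_T2_butlast_def)
    then show ?thesis by (simp add: 4 M_nth)
  qed (simp_all add: M_nth 1[simplified] series_T2_butlast_def)
qed

lemma series_T2_butlast_equation:
  "series_T2_butlast = fps_X * (fps_X + fps_const fps_X * series_T2_butlast + M + series_T2_butlast
     + fps_const fps_X * ((series_312 - 1) * series_T2_butlast))"
  (is "_ = fps_X * ?R")
proof (rule fps_ext)
  fix n
  have 1: "word_sum weight_T2 1 = 1"
    by (simp add: word_sum_def weight_T2_def avoids_T2_short asc_eq_adjacent_count adjacent_count_Cons)
  have 2: "word_sum weight_T2_butlast 2 = 2"
    by (simp add: word_sum_def words_of_length_2 weight_T2_butlast_def avoids_T2_short
        asc_eq_adjacent_count adjacent_count_Cons)
  \<comment> \<open>Both words of length 2 have weight 1 here: one comes from the summand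
    \<open>fps_X\<close>, the other from \<open>M\<close>.\<close>
  consider "n = 0" | "n = 1" | "n = 2" | m where "n = Suc m" "m \<ge> 2"
    by (metis One_nat_def Suc_1 Suc_leI less_2_cases_iff not_less not0_implies_Suc)
  then show "fps_nth series_T2_butlast n = fps_nth (fps_X * ?R) n"
  proof cases
    case 3
    then show ?thesis
      by (simp add: M_nth 1[simplified] 2 fps_mult_nth[of "_ - _"] series_T2_butlast_def
          series_312_def weight_312_Nil)
  next
    case 4
    have "fps_nth ((series_312 - 1) * series_T2_butlast) m =
        (\<Sum>i\<in>{1..<m - 1}. word_sum weight_312 i * word_sum weight_T2_butlast (m - i))"
      using 4(2) by (intro fps_nth_series_312_mult) (simp_all add: series_T2_butlast_def)
    moreover have "fps_nth series_T2_butlast m = word_sum weight_T2_butlast m"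
      using 4(2) by (simp add: series_T2_butlast_def)
    ultimately have "fps_nth ?R m = word_sum weight_T2_butlast (Suc m)"
      using 4(2) unfolding word_sum_weight_T2_butlast_Suc[OF 4(2)] by (simp add: M_nth)
    then show ?thesis using 4 by (simp add: series_T2_butlast_def)
  qed (simp_all add: M_nth 1[simplified] series_T2_butlast_def)
qed

theorem theorem20:
  shows "M = fps_X * N / (1 - fps_X * N\<^sup>2)"
proof -
  let ?X = "fps_X :: rat fps fps" and ?y = "fps_const fps_X :: rat fps fps"
    and ?Q = series_T2_butlast
  have N: "N = 1 + ?X * (N - 1 + ?y) * N" by (rule N_equation)
  have A: "?y * ((series_312 - 1) * F) = (N - 1) * F" for F
    by (simp add: N_eq_series_312 mult.assoc)
  have M: "M = ?X * (1 + ?y * M + M + (N - 1) * (M - ?X) + ?y * ?Q)"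
    using M_equation unfolding A .
  have Q: "?Q = ?X * (?X + ?y * ?Q + M + ?Q + (N - 1) * ?Q)"
    using series_T2_butlast_equation unfolding A .
  \<comment> \<open>Collecting \<open>M\<close> in its equation and \<open>?Q\<close> in its own
    leaves the same coefficient \<open>d\<close>; by the Narayana equation \<open>N * d\<close> is
    \<open>1 - ?X * N\<close>. Multiplying by \<open>N\<close> twice therefore eliminates
    \<open>d\<close>.\<close>
  define d where "d = 1 - ?X * ?y - ?X * N"
  have Nd: "N * d = 1 - ?X * N" using N unfolding d_def by algebra
  have Md: "M * d = ?X * (1 - ?X * (N - 1) + ?y * ?Q)" using M unfolding d_def by algebra
  have Qd: "?Q * d = ?X * (?X + M)" using Q unfolding d_def by algebra
  have "M * d * d = ?X * (d * (1 - ?X * (N - 1)) + ?y * (?X * (?X + M)))"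
    using Md Qd by algebra
  then have "M * (N * d) * (N * d) =
      ?X * ((N * d) * N * (1 - ?X * (N - 1)) + ?X * (?y * N\<^sup>2) * (?X + M))"
    by algebra
  \<comment> \<open>The Narayana equation solved for the term with \<open>y\<close>. It removes
    \<open>y\<close> and exposes the common factor \<open>1 - ?X * N\<close>, which is nonzero and
    cancels.\<close>
  moreover have y: "?X * ?y * N\<^sup>2 = N * (N - 1) * (1 - ?X * N)"
    using N by algebra
  ultimately have "(1 - ?X * N) * (M * (1 - ?X * N\<^sup>2)) = (1 - ?X * N) * (?X * N)"
    unfolding Nd by algebra
  moreover have unit: "1 - ?X * F \<noteq> 0" for F
  proof -
    have "fps_nth (1 - ?X * F) 0 \<noteq> 0" by simp
    then show ?thesis by (metis fps_zero_nth)
  qed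
  ultimately have "M * (1 - ?X * N\<^sup>2) = ?X * N"
    by (metis mult_left_cancel)
  also have "\<dots> = ?X * N / (1 - ?X * N\<^sup>2) * (1 - ?X * N\<^sup>2)"
    by (rule quotient_wellformed[symmetric])
  finally show ?thesis
    using unit[of "N\<^sup>2"] by (metis mult_right_cancel)
qed

end
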